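(* Let $G$ be a self-similar group over a finite alphabet $X$, let $S$ be the associated inverse semigroup and let $K$ be a field. Suppose that $G$ is contracting with nucleus $N$. If $I_K(S)\setminus\mathcal T_K(S)\neq\emptyset$, then $I_K(S)\setminus\mathcal T_K(S)$ intersects $KN$, the $K$-linear span of $N$ in $KG\subseteq K_0S$.
   Context: $X$ is a finite alphabet with $|X|\ge 2$; $X^*$ is the free monoid on $X$ (empty word $\varepsilon$). A self-similar group over $X$ is a group $G$ with a faithful action on $X^*$ by length-preserving permutations such that for all $g\in G$, $x\in X$ there is $g|_x\in G$ (the section of $g$ at $x$) with $g(xw)=g(x)\,g|_x(w)$ for all $w\in X^*$. Put $g|_\varepsilon=g$, $g|_{xv}=(g|_x)|_v$. $G$ is contracting if there is a finite subset $N\subseteq G$ closed under taking sections such that for every $g\in G$ there exists $n\in\mathbb N$ with $g|_w\in N$ for all words $w$ of length $n$; the smallest such set is called the nucleus of $G$. The associated inverse semigroup $S$ consists of $0$ and all (formally distinct) elements $ugv^*$ with $u,v\in X^*$, $g\in G$, with product $(ugv^* )(whz^* )=u\,g(w')\,g|_{w'}h\,z^*$ if $w=vw'$; $(ugv^* )(whz^* )=u\,g\,h|_{h^{-1}(v')}\,(z\,h^{-1}(v'))^*$ if $v=wv'$; and $0$ if $v,w$ are not prefix-comparable. $G$ is identified with the elements $\varepsilon g\varepsilon^*$ of $S$. The nonzero idempotents are the $ww^*$, $w\in X^*$, and $E(S)$ is the semilattice of idempotents ($e\le f$ iff $ef=e$). $K_0S$ is the contracted semigroup algebra: the $K$-algebra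 with basis $S\setminus\{0\}$, with multiplication extending that of $S$ and the zero of $S$ identified with $0$. The singular ideal $I_K(S)$ is the set of $a\in K_0S$ such that for all $0\ne e\in E(S)$ there is $0\neq f\in E(S)$ with $f\le e$ and $af=0$. A set $F\subseteq E(S)$ covers $e\in E(S)$ if $f\le e$ for all $f\in F$ and whenever $0\ne f'\le e$ in $E(S)$, then $f'f\neq 0$ for some $f\in F$. The tight ideal $\mathcal T_K(S)$ is the two-sided ideal of $K_0S$ generated by all products $\prod_{f\in F}(e-f)$ with $e\in E(S)$ and $F\subseteq E(S)$ a finite cover of $e$. *)

theory Defs
  imports "HOL-Algebra.Group_Action" "HOL-Algebra.Ideal" "HOL-Library.Sublist"
begin

section \<open>Self-similar groups\<close>

text \<open>The alphabet is a finite type, and words over it are lists.\<close>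

locale self_similar_group =
  faithful_action G "UNIV :: 'x::finite list set" act
  for G :: "('g, 'm) monoid_scheme" (structure) and act :: "'g \<Rightarrow> 'x::finite list \<Rightarrow> 'x::finite list" +
  assumes alphabet: "card (UNIV :: 'x::finite set) \<ge> 2"
    and length_act: "g \<in> carrier G \<Longrightarrow> length (act g w) = length w"
    and self_similar:
      "g \<in> carrier G \<Longrightarrow> \<exists>k \<in> carrier G. \<forall>w. act g (x # w) = act g [x] @ act k w"

text \<open>The section of \<open>g\<close> at a letter exists by self-similarity and is unique by faithfulness.\<close>

definition letter_section ::
    "('g, 'm) monoid_scheme \<Rightarrow> ('g \<Rightarrow> 'x list \<Rightarrow> 'x list) \<Rightarrow> 'g \<Rightarrow> 'x \<Rightarrow> 'g" where
  "letter_section G act g x =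
     (THE k. k \<in> carrier G \<and> (\<forall>w. act g (x # w) = act g [x] @ act k w))"

fun word_section ::
    "('g, 'm) monoid_scheme \<Rightarrow> ('g \<Rightarrow> 'x list \<Rightarrow> 'x list) \<Rightarrow> 'g \<Rightarrow> 'x list \<Rightarrow> 'g" where
  "word_section G act g [] = g"
| "word_section G act g (x # v) = word_section G act (letter_section G act g x) v"

definition contracting_set ::
    "('g, 'm) monoid_scheme \<Rightarrow> ('g \<Rightarrow> 'x list \<Rightarrow> 'x list) \<Rightarrow> 'g set \<Rightarrow> bool" where
  "contracting_set G act N \<longleftrightarrow>
     finite N \<and> N \<subseteq> carrier G \<and>
     (\<forall>g \<in> N. \<forall>x. letter_section G act g x \<in> N) \<and>
     (\<forall>g \<in> carrier G. \<exists>n. \<forall>w. length w = n \<longrightarrow> word_section G act g w \<in> N)"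

definition contracting ::
    "('g, 'm) monoid_scheme \<Rightarrow> ('g \<Rightarrow> 'x list \<Rightarrow> 'x list) \<Rightarrow> bool" where
  "contracting G act \<longleftrightarrow> (\<exists>N. contracting_set G act N)"

definition is_nucleus ::
    "('g, 'm) monoid_scheme \<Rightarrow> ('g \<Rightarrow> 'x list \<Rightarrow> 'x list) \<Rightarrow> 'g set \<Rightarrow> bool" where
  "is_nucleus G act N \<longleftrightarrow>
     contracting_set G act N \<and> (\<forall>M. contracting_set G act M \<longrightarrow> N \<subseteq> M)"


section \<open>The associated inverse semigroup\<close>

text \<open>\<open>Elt u g v\<close> stands for the formal element \<open>u g v\<^sup>*\<close>.\<close>

datatype ('x, 'g) isg = Zero | Elt "'x list" 'g "'x list"

fun isg_mult ::
    "('g, 'm) monoid_scheme \<Rightarrow> ('g \<Rightarrow> 'x list \<Rightarrow> 'x list) \<Rightarrow>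
     ('x, 'g) isg \<Rightarrow> ('x, 'g) isg \<Rightarrow> ('x, 'g) isg" where
  "isg_mult G act (Elt u g v) (Elt w h z) =
     (if prefix v w then
        (let w' = drop (length v) w in
           Elt (u @ act g w') (word_section G act g w' \<otimes>\<^bsub>G\<^esub> h) z)
      else if prefix w v then
        (let v' = drop (length w) v; y = act (inv\<^bsub>G\<^esub> h) v' in
           Elt u (g \<otimes>\<^bsub>G\<^esub> word_section G act h y) (z @ y))
      else Zero)"
| "isg_mult G act Zero t = Zero"
| "isg_mult G act t Zero = Zero"

definition isg_monoid ::
    "('g, 'm) monoid_scheme \<Rightarrow> ('g \<Rightarrow> 'x list \<Rightarrow> 'x list) \<Rightarrow> ('x, 'g) isg monoid" where
  "isg_monoid G act =
     \<lparr>carrier = {Zero} \<union> {Elt u g v | u g v. g \<in> carrier G},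
      mult = isg_mult G act,
      one = Elt [] \<one>\<^bsub>G\<^esub> []\<rparr>"


section \<open>Idempotents and the contracted algebra of a monoid with zero\<close>

text \<open>In this section \<open>z\<close> is the zero element of the monoid \<open>M\<close>.\<close>

definition idempotents :: "('s, 'm) monoid_scheme \<Rightarrow> 's set" where
  "idempotents M = {e \<in> carrier M. e \<otimes>\<^bsub>M\<^esub> e = e}"

definition idem_le :: "('s, 'm) monoid_scheme \<Rightarrow> 's \<Rightarrow> 's \<Rightarrow> bool" where
  "idem_le M e f \<longleftrightarrow> e \<otimes>\<^bsub>M\<^esub> f = e"

definition covers :: "('s, 'm) monoid_scheme \<Rightarrow> 's \<Rightarrow> 's set \<Rightarrow> 's \<Rightarrow> bool" where
  "covers M z F e \<longleftrightarrow>
     F \<subseteq> idempotents M \<and> (\<forall>f \<in> F. idem_le M f e) \<and>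
     (\<forall>f' \<in> idempotents M. f' \<noteq> z \<and> idem_le M f' e \<longrightarrow> (\<exists>f \<in> F. f' \<otimes>\<^bsub>M\<^esub> f \<noteq> z))"

text \<open>Elements of the contracted algebra are given by their coefficient functions, which are
  finitely supported on the nonzero elements of \<open>M\<close>.\<close>

definition contracted_algebra ::
    "('s, 'm) monoid_scheme \<Rightarrow> 's \<Rightarrow> ('s \<Rightarrow> 'k::field) ring" where
  "contracted_algebra M z =
     \<lparr>carrier = {a. finite {s. a s \<noteq> 0} \<and> {s. a s \<noteq> 0} \<subseteq> carrier M - {z}},
      mult = (\<lambda>a b s. if s = z then 0
        else \<Sum>(t, u) \<in> {(t, u). a t \<noteq> 0 \<and> b u \<noteq> 0 \<and> t \<otimes>\<^bsub>M\<^esub> u = s}. a t * b u),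
      one = (\<lambda>s. if s = \<one>\<^bsub>M\<^esub> \<and> s \<noteq> z then 1 else 0),
      zero = (\<lambda>s. 0),
      add = (\<lambda>a b s. a s + b s)\<rparr>"

text \<open>The image of an element of \<open>M\<close> in the contracted algebra; the zero of \<open>M\<close> is sent to \<open>0\<close>.\<close>

definition basis_elt :: "'s \<Rightarrow> 's \<Rightarrow> ('s \<Rightarrow> 'k::field)" where
  "basis_elt z s = (\<lambda>t. if t = s \<and> t \<noteq> z then 1 else 0)"

definition lin_span :: "('s \<Rightarrow> 'k::field) set \<Rightarrow> ('s \<Rightarrow> 'k) set" where
  "lin_span B = {\<lambda>s. \<Sum>b\<in>F. c b * b s | F c. finite F \<and> F \<subseteq> B}"

definition singular_ideal ::
    "('s, 'm) monoid_scheme \<Rightarrow> 's \<Rightarrow> ('s \<Rightarrow> 'k::field) set" where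
  "singular_ideal M z =
     (let A = contracted_algebra M z in
      {a \<in> carrier A. \<forall>e \<in> idempotents M. e \<noteq> z \<longrightarrow>
         (\<exists>f \<in> idempotents M. f \<noteq> z \<and> idem_le M f e \<and> a \<otimes>\<^bsub>A\<^esub> basis_elt z f = \<zero>\<^bsub>A\<^esub>)})"

text \<open>The product of all \<open>e - f\<close> with \<open>f\<close> running through the list \<open>fs\<close>, formed in the corner
  algebra with unit \<open>e\<close>. So the empty product is \<open>e\<close>; the leading factor \<open>e\<close> has no effect on
  nonempty products when \<open>f \<le> e\<close> for all \<open>f\<close> in \<open>fs\<close>.\<close>

definition diff_prod ::
    "('s, 'm) monoid_scheme \<Rightarrow> 's \<Rightarrow> 's \<Rightarrow> 's list \<Rightarrow> ('s \<Rightarrow> 'k::field)" where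
  "diff_prod M z e fs =
     (let A = contracted_algebra M z in
      foldl (\<lambda>p f. p \<otimes>\<^bsub>A\<^esub> (basis_elt z e \<ominus>\<^bsub>A\<^esub> basis_elt z f)) (basis_elt z e) fs)"

text \<open>A finite set \<open>F\<close> is enumerated by a list without repetitions. When idempotents commute,
  the order of the enumeration is irrelevant. As the algebra is unital, its ring ideals are
  subspaces.\<close>

definition tight_ideal ::
    "('s, 'm) monoid_scheme \<Rightarrow> 's \<Rightarrow> ('s \<Rightarrow> 'k::field) set" where
  "tight_ideal M z =
     Idl\<^bsub>contracted_algebra M z\<^esub>
       {diff_prod M z e fs | e fs. e \<in> idempotents M \<and> distinct fs \<and> covers M z (set fs) e}"

end

theory Submission
  imports Defs
begin

text \<open>
  Modulo the tight ideal the identity is the sum of the idempotents \<open>w w\<^sup>*\<close> over all words \<open>w\<close> of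
  a fixed length \<open>n\<close>, because these words cover the identity. So an element \<open>a\<close> outside the tight
  ideal has a product \<open>a w\<close> outside it, with \<open>w\<close> as long as desired
  (\<open>nonmember_times_long_word\<close>). When \<open>w\<close> is long, it absorbs every factor \<open>v\<^sup>*\<close> of the terms
  \<open>u g v\<^sup>*\<close> of \<open>a\<close>, and it pushes every group element down to a section in the nucleus; hence
  \<open>a w\<close> is a combination of elements \<open>u g\<close> with \<open>u\<close> a word and \<open>g \<in> N\<close>
  (\<open>support_mult_long_word\<close>).

  Collecting the terms by \<open>u\<close> gives a finite sum \<open>a w = \<Sum> u c\<^sub>u\<close> with all \<open>c\<^sub>u\<close> in the span of \<open>N\<close>.
  One of the \<open>c\<^sub>u\<close> lies outside the tight ideal, since otherwise \<open>a w\<close> would lie in it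
  (\<open>ideal_contains_sum_group_parts\<close>). The singular ideal contains \<open>a w\<close> with \<open>a\<close>
  (\<open>singular_ideal_mult_word\<close>), and it also contains every \<open>c\<^sub>u\<close>: the terms of \<open>u c\<^sub>u p p\<^sup>*\<close>
  have the form \<open>u y h p\<^sup>*\<close> with \<open>y\<close> as long as \<open>p\<close>, so \<open>u\<close> can be read off from them and nothing
  cancels between different \<open>u\<close>. Whatever \<open>p p\<^sup>*\<close> annihilates \<open>a w\<close> therefore annihilates each \<open>c\<^sub>u\<close>
  (\<open>group_part_singular\<close>).
\<close>


section \<open>Products with basis elements\<close>

lemma carrier_contracted_algebra:
  "a \<in> carrier (contracted_algebra M z) \<longleftrightarrow>
     finite {s. a s \<noteq> 0} \<and> {s. a s \<noteq> 0} \<subseteq> carrier M - {z}"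
  by (simp add: contracted_algebra_def)

lemma basis_elt_closed:
  fixes s :: 's
  assumes "s \<in> carrier M"
  shows "(basis_elt z s :: 's \<Rightarrow> 'k::field) \<in> carrier (contracted_algebra M z)"
proof -
  have "{t. (basis_elt z s :: 's \<Rightarrow> 'k) t \<noteq> 0} \<subseteq> {s} - {z}"
    by (auto simp: basis_elt_def)
  with assms show ?thesis
    unfolding carrier_contracted_algebra by (auto intro: finite_subset)
qed

lemma mult_basis_elt:
  fixes a :: "'s \<Rightarrow> 'k::field"
  assumes "t \<noteq> z"
  shows "(a \<otimes>\<^bsub>contracted_algebra M z\<^esub> basis_elt z t) s =
           (if s = z then 0 else \<Sum>r | a r \<noteq> 0 \<and> r \<otimes>\<^bsub>M\<^esub> t = s. a r)"
proof -
  have pairs: "{(r, u). a r \<noteq> 0 \<and> (basis_elt z t :: 's \<Rightarrow> 'k) u \<noteq> 0 \<and> r \<otimes>\<^bsub>M\<^esub> u = s} =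
      (\<lambda>r. (r, t)) ` {r. a r \<noteq> 0 \<and> r \<otimes>\<^bsub>M\<^esub> t = s}"
    using assms by (auto simp: basis_elt_def split: if_splits)
  have "inj_on (\<lambda>r. (r, t)) {r. a r \<noteq> 0 \<and> r \<otimes>\<^bsub>M\<^esub> t = s}"
    by (auto simp: inj_on_def)
  with assms show ?thesis
    by (simp add: contracted_algebra_def pairs sum.reindex o_def) (simp add: basis_elt_def)
qed

lemma basis_elt_mult:
  fixes a :: "'s \<Rightarrow> 'k::field"
  assumes "t \<noteq> z"
  shows "(basis_elt z t \<otimes>\<^bsub>contracted_algebra M z\<^esub> a) s =
           (if s = z then 0 else \<Sum>r | a r \<noteq> 0 \<and> t \<otimes>\<^bsub>M\<^esub> r = s. a r)"
proof -
  have pairs: "{(u, r). (basis_elt z t :: 's \<Rightarrow> 'k) u \<noteq> 0 \<and> a r \<noteq> 0 \<and> u \<otimes>\<^bsub>M\<^esub> r = s} =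
      (\<lambda>r. (t, r)) ` {r. a r \<noteq> 0 \<and> t \<otimes>\<^bsub>M\<^esub> r = s}"
    using assms by (auto simp: basis_elt_def split: if_splits)
  have "inj_on (\<lambda>r. (t, r)) {r. a r \<noteq> 0 \<and> t \<otimes>\<^bsub>M\<^esub> r = s}"
    by (auto simp: inj_on_def)
  with assms show ?thesis
    by (simp add: contracted_algebra_def pairs sum.reindex o_def) (simp add: basis_elt_def)
qed

lemma basis_elt_mult_basis_elt:
  fixes s t :: 's
  assumes "s \<noteq> z" "t \<noteq> z"
  shows "(basis_elt z s \<otimes>\<^bsub>contracted_algebra M z\<^esub> basis_elt z t :: 's \<Rightarrow> 'k::field) =
           basis_elt z (s \<otimes>\<^bsub>M\<^esub> t)"
proof
  fix y
  have "{r. (basis_elt z s :: 's \<Rightarrow> 'k) r \<noteq> 0 \<and> r \<otimes>\<^bsub>M\<^esub> t = y} =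
      (if s \<otimes>\<^bsub>M\<^esub> t = y then {s} else {})"
    using assms by (auto simp: basis_elt_def)
  then show "(basis_elt z s \<otimes>\<^bsub>contracted_algebra M z\<^esub> basis_elt z t :: 's \<Rightarrow> 'k) y =
      basis_elt z (s \<otimes>\<^bsub>M\<^esub> t) y"
    using assms by (simp add: mult_basis_elt) (simp add: basis_elt_def)
qed

text \<open>The coefficients in a linear span are indexed by vectors, so the value of \<open>a\<close> at \<open>s\<close> is read
  off from the vector of \<open>s\<close>. This works because distinct elements other than \<open>z\<close> have distinct
  vectors.\<close>

lemma supported_in_lin_span:
  fixes a :: "'s \<Rightarrow> 'k::field"
  assumes "finite P" "z \<notin> P" and supp: "\<And>s. a s \<noteq> 0 \<Longrightarrow> s \<in> P"
  shows "a \<in> lin_span (basis_elt z ` P)"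
proof -
  let ?b = "basis_elt z :: 's \<Rightarrow> 's \<Rightarrow> 'k"
  have inj: "inj_on ?b P"
  proof (rule inj_onI)
    fix s t assume "s \<in> P" "t \<in> P" "?b s = ?b t"
    then have "?b s s = ?b t s" by simp
    with \<open>s \<in> P\<close> \<open>z \<notin> P\<close> show "s = t"
      by (auto simp: basis_elt_def split: if_splits)
  qed
  have "a s = (\<Sum>b \<in> ?b ` P. a (inv_into P ?b b) * b s)" for s
  proof -
    have "(\<Sum>b \<in> ?b ` P. a (inv_into P ?b b) * b s) = (\<Sum>t\<in>P. a t * ?b t s)"
      using inj by (simp add: sum.reindex)
    also have "\<dots> = (\<Sum>t\<in>P. if t = s then a s else 0)"
      using \<open>z \<notin> P\<close> by (intro sum.cong) (auto simp: basis_elt_def)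
    also have "\<dots> = a s"
      using \<open>finite P\<close> supp[of s] by auto
    finally show ?thesis ..
  qed
  then have "a = (\<lambda>s. \<Sum>b \<in> ?b ` P. a (inv_into P ?b b) * b s)" ..
  moreover have "finite (?b ` P)" using \<open>finite P\<close> by simp
  ultimately show ?thesis
    unfolding lin_span_def mem_Collect_eq
    by (intro exI[of _ "?b ` P"] exI[of _ "\<lambda>b. a (inv_into P ?b b)"]) simp
qed


section \<open>Covers modulo the tight ideal\<close>

text \<open>The inductive step for long products: a right factor that fixes \<open>a\<close> modulo the ideal may be
  appended to anything congruent to \<open>a\<close>.\<close>

lemma (in ideal) cong_trans_mult:
  assumes [simp]: "p \<in> carrier R" "q \<in> carrier R" "a \<in> carrier R"
    and "p \<ominus> a \<in> I" "a \<otimes> q \<ominus> a \<in> I"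
  shows "p \<otimes> q \<ominus> a \<in> I"
proof -
  have "(p \<ominus> a) \<otimes> q \<oplus> (a \<otimes> q \<ominus> a) \<in> I"
    using assms
    by (intro additive_subgroup.a_closed[OF is_additive_subgroup] I_r_closed)
  also have "(p \<ominus> a) \<otimes> q \<oplus> (a \<otimes> q \<ominus> a) = p \<otimes> q \<ominus> a"
    by (simp add: minus_eq l_distr l_minus a_assoc r_neg1)
  finally show ?thesis .
qed

text \<open>In \<open>a (e - f\<^sub>1) \<dots> (e - f\<^sub>k)\<close> every factor acts on \<open>a\<close> as \<open>e\<close> modulo \<open>J\<close> as soon as all
  \<open>a f\<^sub>i\<close> lie in \<open>J\<close>. So the product is then congruent to \<open>a e = a\<close>; but it is a multiple of a
  generator of the tight ideal.\<close>

lemma nonmember_times_cover: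
  fixes a :: "'s \<Rightarrow> 'k::field"
  assumes J: "ideal J (contracted_algebra M z)"
    and tight: "{diff_prod M z e fs | e fs.
                   e \<in> idempotents M \<and> distinct fs \<and> covers M z (set fs) e} \<subseteq> J"
    and e: "e \<in> idempotents M" and F: "finite F" "covers M z F e"
    and a: "a \<in> carrier (contracted_algebra M z)" "a \<notin> J"
    and ae: "a \<otimes>\<^bsub>contracted_algebra M z\<^esub> basis_elt z e = a"
  shows "\<exists>f\<in>F. a \<otimes>\<^bsub>contracted_algebra M z\<^esub> basis_elt z f \<notin> J"
proof (rule ccontr)
  assume "\<not> ?thesis"
  then have aF: "\<And>f. f \<in> F \<Longrightarrow> a \<otimes>\<^bsub>contracted_algebra M z\<^esub> basis_elt z f \<in> J"
    by blast
  define A where "A = (contracted_algebra M z :: ('s \<Rightarrow> 'k) ring)"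
  let ?d = "\<lambda>f. basis_elt z e \<ominus>\<^bsub>A\<^esub> basis_elt z f"
  interpret ideal J A
    using J by (simp add: A_def)
  obtain fs where fs: "set fs = F" "distinct fs"
    using finite_distinct_list F(1) by blast
  have E [simp]: "basis_elt z e \<in> carrier A"
    using e by (auto simp: A_def idempotents_def intro: basis_elt_closed)
  have B [simp]: "basis_elt z f \<in> carrier A" if "f \<in> F" for f
    using F(2) that by (auto simp: A_def covers_def idempotents_def intro!: basis_elt_closed)
  have aA [simp]: "a \<in> carrier A" using a by (simp add: A_def)
  have step: "a \<otimes>\<^bsub>A\<^esub> ?d f \<ominus>\<^bsub>A\<^esub> a \<in> J" if "f \<in> F" for f
  proof -
    have af: "a \<otimes>\<^bsub>A\<^esub> basis_elt z f \<in> J" using aF that by (simp add: A_def)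
    have "a \<otimes>\<^bsub>A\<^esub> ?d f \<ominus>\<^bsub>A\<^esub> a = \<ominus>\<^bsub>A\<^esub> (a \<otimes>\<^bsub>A\<^esub> basis_elt z f)"
      using that ae[folded A_def]
      by (simp add: minus_eq r_distr r_minus a_ac r_neg2 r_neg1 r_neg)
    with af show ?thesis by simp
  qed
  have cong: "p \<in> carrier A \<Longrightarrow> p \<ominus>\<^bsub>A\<^esub> a \<in> J \<Longrightarrow> set gs \<subseteq> F \<Longrightarrow>
      foldl (\<lambda>p f. p \<otimes>\<^bsub>A\<^esub> ?d f) p gs \<ominus>\<^bsub>A\<^esub> a \<in> J" for p gs
  proof (induction gs arbitrary: p)
    case (Cons g gs)
    then show ?case
      using cong_trans_mult[of p "?d g" a] step[of g] by simp
  qed simp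
  have assoc: "p \<in> carrier A \<Longrightarrow> set gs \<subseteq> F \<Longrightarrow>
      foldl (\<lambda>p f. p \<otimes>\<^bsub>A\<^esub> ?d f) p gs \<in> carrier A \<and>
      a \<otimes>\<^bsub>A\<^esub> foldl (\<lambda>p f. p \<otimes>\<^bsub>A\<^esub> ?d f) p gs =
      foldl (\<lambda>p f. p \<otimes>\<^bsub>A\<^esub> ?d f) (a \<otimes>\<^bsub>A\<^esub> p) gs" for p gs
    by (induction gs arbitrary: p) (auto simp: m_assoc)
  let ?D = "diff_prod M z e fs"
  have D: "?D = foldl (\<lambda>p f. p \<otimes>\<^bsub>A\<^esub> ?d f) (basis_elt z e) fs"
    by (simp add: diff_prod_def Let_def A_def)
  have "?D \<in> J" using tight e fs F(2) by auto
  then have aD: "a \<otimes>\<^bsub>A\<^esub> ?D \<in> J" by (simp add: I_l_closed)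
  have "a \<otimes>\<^bsub>A\<^esub> ?D = foldl (\<lambda>p f. p \<otimes>\<^bsub>A\<^esub> ?d f) a fs"
    using assoc[of "basis_elt z e" fs] fs ae[folded A_def] by (simp add: D)
  with cong[of a fs] fs have "a \<otimes>\<^bsub>A\<^esub> ?D \<ominus>\<^bsub>A\<^esub> a \<in> J"
    by (simp add: minus_eq r_neg)
  then have "a \<otimes>\<^bsub>A\<^esub> ?D \<ominus>\<^bsub>A\<^esub> (a \<otimes>\<^bsub>A\<^esub> ?D \<ominus>\<^bsub>A\<^esub> a) \<in> J"
    using aD by (simp add: minus_eq)
  also have "a \<otimes>\<^bsub>A\<^esub> ?D \<ominus>\<^bsub>A\<^esub> (a \<otimes>\<^bsub>A\<^esub> ?D \<ominus>\<^bsub>A\<^esub> a) = a"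
    using a_Hcarr[OF aD] by (simp add: minus_eq minus_add r_neg2 r_neg1 r_neg)
  finally show False using a by blast
qed

text \<open>Choosing one ideal \<open>J\<close> that separates \<open>a\<close> from the generators of the tight ideal also makes
  the ring axioms of the contracted algebra available: they are part of what it means for \<open>J\<close> to
  be an ideal. Associativity in particular is used through \<open>J\<close> throughout.\<close>

lemma not_in_tight_idealD:
  assumes "a \<notin> tight_ideal M z"
  obtains J where "ideal J (contracted_algebra M z)" "a \<notin> J"
    "{diff_prod M z e fs | e fs.
        e \<in> idempotents M \<and> distinct fs \<and> covers M z (set fs) e} \<subseteq> J"
  using assms unfolding tight_ideal_def genideal_def by blast


section \<open>Sections of a self-similar group\<close>

context self_similar_group
begin

lemma group_G: "group G"
  using group_hom group_hom.axioms(1) by blast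

lemma act_one: "act \<one> w = w"
  using id_eq_one by (metis UNIV_I restrict_apply)

lemma letter_section_unique:
  assumes "k \<in> carrier G" "\<And>w. act g (x # w) = act g [x] @ act k w"
  shows "letter_section G act g x = k"
  unfolding letter_section_def
proof (rule the_equality)
  fix l assume l: "l \<in> carrier G \<and> (\<forall>w. act g (x # w) = act g [x] @ act l w)"
  have "act l w = act k w" for w
    using l assms(2) by (metis same_append_eq)
  then have "act l = act k" ..
  then show "l = k"
    by (rule inj_onD[OF faithful _ conjunct1[OF l] assms(1)])
qed (use assms in blast)

lemma letter_section_closed: "g \<in> carrier G \<Longrightarrow> letter_section G act g x \<in> carrier G"
proof -
  assume "g \<in> carrier G"
  then obtain k where k: "k \<in> carrier G" "\<forall>w. act g (x # w) = act g [x] @ act k w"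
    using self_similar by blast
  then have "letter_section G act g x = k"
    by (intro letter_section_unique) blast+
  with k(1) show ?thesis by simp
qed

lemma word_section_closed: "g \<in> carrier G \<Longrightarrow> word_section G act g w \<in> carrier G"
  by (induction w arbitrary: g) (auto simp: letter_section_closed)

lemma word_section_append:
  "word_section G act g (u @ v) = word_section G act (word_section G act g u) v"
  by (induction u arbitrary: g) auto

lemma word_section_one: "word_section G act \<one> w = \<one>"
proof -
  interpret group G by (rule group_G)
  have "letter_section G act \<one> x = \<one>" for x
    by (rule letter_section_unique) (auto simp: act_one)
  then show ?thesis by (induction w) auto
qed

text \<open>The contracting condition speaks of a single level of the tree; closure of \<open>N\<close> under sections
  carries it to all deeper levels. This makes it possible to treat finitely many group elements
  at once.\<close>

lemma contracting_set_eventually: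
  assumes N: "contracting_set G act N" and g: "g \<in> carrier G"
  obtains n where "\<And>w. length w \<ge> n \<Longrightarrow> word_section G act g w \<in> N"
proof -
  obtain n where n: "\<And>w. length w = n \<Longrightarrow> word_section G act g w \<in> N"
    using N g unfolding contracting_set_def by blast
  have closed: "h \<in> N \<Longrightarrow> word_section G act h w \<in> N" for h w
    using N by (induction w arbitrary: h) (auto simp: contracting_set_def)
  have "word_section G act g w \<in> N" if "length w \<ge> n" for w
    using closed[OF n[of "take n w"], of "drop n w"] that
    by (simp flip: word_section_append)
  then show ?thesis using that by blast
qed


section \<open>Multiplication and idempotents\<close>

abbreviation "S \<equiv> isg_monoid G act"

lemma mem_carrier_S: "s \<in> carrier S \<longleftrightarrow> (s = Zero \<or> (\<exists>u g v. s = Elt u g v \<and> g \<in> carrier G))"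
  by (auto simp: isg_monoid_def)

lemma mult_S: "s \<otimes>\<^bsub>S\<^esub> t = isg_mult G act s t"
  by (simp add: isg_monoid_def)

lemma one_S: "\<one>\<^bsub>S\<^esub> = Elt [] \<one> []"
  by (simp add: isg_monoid_def)

lemma Elt_closed: "g \<in> carrier G \<Longrightarrow> Elt u g v \<in> carrier S"
  by (simp add: mem_carrier_S)

text \<open>The next products are the ones that occur when elements are multiplied by words or by
  idempotents. In contrast to the general multiplication rule, they need no comparison of
  prefixes in their statements.\<close>

lemma word_mult_group_elt:
  assumes "g \<in> carrier G"
  shows "Elt u \<one> [] \<otimes>\<^bsub>S\<^esub> Elt [] g [] = Elt u g []"
proof -
  interpret group G by (rule group_G)
  show ?thesis using assms by (simp add: mult_S act_one)
qed

lemma mult_idempotent: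
  assumes "g \<in> carrier G"
  shows "Elt u g [] \<otimes>\<^bsub>S\<^esub> Elt z \<one> z = Elt (u @ act g z) (word_section G act g z) z"
proof -
  interpret group G by (rule group_G)
  show ?thesis using assms by (simp add: mult_S word_section_closed)
qed

lemma idempotent_mult_word: "Elt (w @ q) \<one> (w @ q) \<otimes>\<^bsub>S\<^esub> Elt w \<one> [] = Elt (w @ q) \<one> q"
proof -
  interpret group G by (rule group_G)
  show ?thesis
    by (cases "q = []") (auto simp: mult_S act_one word_section_one prefix_def)
qed

lemma word_mult_star: "Elt w \<one> [] \<otimes>\<^bsub>S\<^esub> Elt [] \<one> w = Elt w \<one> w"
proof -
  interpret group G by (rule group_G)
  show ?thesis by (simp add: mult_S act_one)
qed

text \<open>The action preserves lengths, so in a product of \<open>u g v\<^sup>*\<close> with itself one of the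
  two outer words grows by the difference of the lengths of \<open>u\<close> and \<open>v\<close>. For an idempotent this
  forces \<open>u = v\<close>, and then \<open>g\<close> is an idempotent of the group.\<close>

lemma nonzero_idempotents: "e \<in> idempotents S \<and> e \<noteq> Zero \<longleftrightarrow> (\<exists>v. e = Elt v \<one> v)"
proof -
  interpret group G by (rule group_G)
  show ?thesis
  proof
    assume e: "e \<in> idempotents S \<and> e \<noteq> Zero"
    then obtain u g v where g: "e = Elt u g v" "g \<in> carrier G"
      by (auto simp: idempotents_def mem_carrier_S)
    have m: "isg_mult G act (Elt u g v) (Elt u g v) = Elt u g v"
      using e g by (simp add: idempotents_def mult_S)
    have "u = v \<and> g \<otimes> g = g"
    proof (cases "prefix v u")
      case True
      then obtain x where x: "u = v @ x" by (auto simp: prefix_def)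
      then have "length (u @ act g x) = length u" using m by simp
      then have "x = []" using g length_act by simp
      with x m show ?thesis by simp
    next
      case False
      then have "prefix u v" using m by (auto split: if_splits)
      then obtain x where x: "v = u @ x" by (auto simp: prefix_def)
      then have "length (v @ act (inv g) x) = length v" using m False by (simp add: Let_def)
      then have "x = []" using g length_act by simp
      with x False show ?thesis by simp
    qed
    with g show "\<exists>v. e = Elt v \<one> v" by auto
  next
    assume "\<exists>v. e = Elt v \<one> v"
    then show "e \<in> idempotents S \<and> e \<noteq> Zero"
      by (auto simp: idempotents_def mem_carrier_S mult_S act_one)
  qed
qed

lemma idem_le_idempotent: "idem_le S (Elt (v @ r) \<one> (v @ r)) (Elt v \<one> v)"
proof -
  interpret group G by (rule group_G)
  show ?thesis
    by (cases "r = []") (auto simp: idem_le_def mult_S act_one word_section_one prefix_def)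
qed

lemma idem_le_idempotentD:
  assumes "idem_le S (Elt p \<one> p) (Elt v \<one> v)"
  shows "prefix v p"
proof -
  interpret group G by (rule group_G)
  show ?thesis using assms
    by (auto simp: idem_le_def mult_S act_one prefix_def split: if_splits)
qed

text \<open>Every word is comparable with a word of length \<open>n\<close>: truncate it or extend it.\<close>

lemma words_cover_one:
  "covers S Zero ((\<lambda>w :: 'x list. Elt w \<one> w) ` {w. length w = n}) \<one>\<^bsub>S\<^esub>"
  unfolding covers_def
proof (intro conjI ballI impI)
  show "(\<lambda>w :: 'x list. Elt w \<one> w) ` {w. length w = n} \<subseteq> idempotents S"
    using nonzero_idempotents by auto
next
  fix f assume "f \<in> (\<lambda>w :: 'x list. Elt w \<one> w) ` {w. length w = n}"
  then show "idem_le S f \<one>\<^bsub>S\<^esub>"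
    using idem_le_idempotent[of "[]"] by (auto simp: one_S)
next
  fix f assume "f \<in> idempotents S" "f \<noteq> Zero \<and> idem_le S f \<one>\<^bsub>S\<^esub>"
  then obtain v where v: "f = Elt v \<one> v" using nonzero_idempotents by blast
  obtain w where w: "length w = n" "prefix v w \<or> prefix w v"
  proof (cases "length v \<ge> n")
    case True
    then show ?thesis by (intro that[of "take n v"]) (auto simp: take_is_prefix)
  next
    case False
    then show ?thesis
      by (intro that[of "v @ replicate (n - length v) undefined"]) auto
  qed
  then have "f \<otimes>\<^bsub>S\<^esub> Elt w \<one> w \<noteq> Zero" by (auto simp: v mult_S Let_def)
  with w(1) show "\<exists>f'\<in>(\<lambda>w :: 'x list. Elt w \<one> w) ` {w. length w = n}. f \<otimes>\<^bsub>S\<^esub> f' \<noteq> Zero"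
    by blast
qed


section \<open>The singular ideal\<close>

abbreviation A :: "(('x, 'g) isg \<Rightarrow> 'k::field) ring" where
  "A \<equiv> contracted_algebra S Zero"

abbreviation \<beta> :: "('x, 'g) isg \<Rightarrow> ('x, 'g) isg \<Rightarrow> 'k::field" where
  "\<beta> \<equiv> basis_elt Zero"

lemma one_closed_G: "\<one> \<in> carrier G"
  using group_G by (rule group.is_monoid[THEN monoid.one_closed])

text \<open>The nonzero idempotents below \<open>v v\<^sup>*\<close> are those of the extensions of \<open>v\<close>, which turns the
  order on idempotents into concatenation of words.\<close>

lemma mem_singular_ideal:
  "(a :: ('x, 'g) isg \<Rightarrow> 'k::field) \<in> singular_ideal S Zero \<longleftrightarrow>
     a \<in> carrier A \<and>
     (\<forall>v. \<exists>r. a \<otimes>\<^bsub>A\<^esub> \<beta> (Elt (v @ r) \<one> (v @ r)) = (\<lambda>s. 0))"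
proof -
  have zero: "\<zero>\<^bsub>A\<^esub> = (\<lambda>s :: ('x, 'g) isg. 0 :: 'k)"
    by (simp add: contracted_algebra_def)
  show ?thesis
  proof (intro iffI conjI allI)
    assume a: "a \<in> singular_ideal S Zero"
    then show "a \<in> carrier A" by (simp add: singular_ideal_def Let_def)
    fix v
    have "Elt v \<one> v \<in> idempotents S \<and> Elt v \<one> v \<noteq> Zero"
      using nonzero_idempotents by blast
    then obtain f where f: "f \<in> idempotents S" "f \<noteq> Zero" "idem_le S f (Elt v \<one> v)"
        "a \<otimes>\<^bsub>A\<^esub> \<beta> f = (\<lambda>s. 0)"
      using a unfolding singular_ideal_def Let_def zero by blast
    then obtain p where p: "f = Elt p \<one> p" using nonzero_idempotents by blast
    with f(3) have "prefix v p" using idem_le_idempotentD by blast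
    with f(4) p show "\<exists>r. a \<otimes>\<^bsub>A\<^esub> \<beta> (Elt (v @ r) \<one> (v @ r)) = (\<lambda>s. 0)"
      by (auto simp: prefix_def)
  next
    assume a: "a \<in> carrier A \<and>
      (\<forall>v. \<exists>r. a \<otimes>\<^bsub>A\<^esub> \<beta> (Elt (v @ r) \<one> (v @ r)) = (\<lambda>s. 0))"
    show "a \<in> singular_ideal S Zero"
      unfolding singular_ideal_def Let_def zero mem_Collect_eq
    proof (intro conjI ballI impI)
      fix e assume "e \<in> idempotents S" "e \<noteq> Zero"
      then obtain v where v: "e = Elt v \<one> v" using nonzero_idempotents by blast
      from a obtain r where "a \<otimes>\<^bsub>A\<^esub> \<beta> (Elt (v @ r) \<one> (v @ r)) = (\<lambda>s. 0)" by blast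
      moreover have "Elt (v @ r) \<one> (v @ r) \<in> idempotents S"
        using nonzero_idempotents by blast
      ultimately show "\<exists>f\<in>idempotents S. f \<noteq> Zero \<and> idem_le S f e \<and> a \<otimes>\<^bsub>A\<^esub> \<beta> f = (\<lambda>s. 0)"
        using idem_le_idempotent v by blast
    qed (use a in blast)
  qed
qed

text \<open>An extension \<open>w q\<close> of \<open>w\<close> satisfies \<open>w (q q\<^sup>*) = (w q) (w q)\<^sup>* w\<close>. So if \<open>a\<close> is
  annihilated by the idempotent of \<open>w q\<close>, then \<open>a w\<close> is annihilated by the idempotent of \<open>q\<close>.\<close>

lemma singular_ideal_mult_word:
  fixes a :: "('x, 'g) isg \<Rightarrow> 'k::field"
  assumes ring: "ring (A :: (('x, 'g) isg \<Rightarrow> 'k) ring)"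
    and a: "a \<in> singular_ideal S Zero"
  shows "a \<otimes>\<^bsub>A\<^esub> \<beta> (Elt w \<one> []) \<in> singular_ideal S Zero"
proof -
  interpret A: ring "A :: (('x, 'g) isg \<Rightarrow> 'k) ring" by (rule ring)
  have cl [simp]: "\<beta> (Elt u \<one> v) \<in> carrier (A :: (('x, 'g) isg \<Rightarrow> 'k) ring)" for u v
    by (intro basis_elt_closed Elt_closed one_closed_G)
  have aA [simp]: "a \<in> carrier A" using a by (simp add: mem_singular_ideal)
  have "\<exists>r. a \<otimes>\<^bsub>A\<^esub> \<beta> (Elt w \<one> []) \<otimes>\<^bsub>A\<^esub> \<beta> (Elt (v @ r) \<one> (v @ r)) = (\<lambda>s. 0)" for v
  proof -
    obtain r where r: "a \<otimes>\<^bsub>A\<^esub> \<beta> (Elt (w @ v @ r) \<one> (w @ v @ r)) = (\<lambda>s. 0)"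
      using a by (auto simp: mem_singular_ideal dest: spec[of _ "w @ v"])
    let ?q = "v @ r"
    have "Elt w \<one> [] \<otimes>\<^bsub>S\<^esub> Elt ?q \<one> ?q = Elt (w @ ?q) \<one> (w @ ?q) \<otimes>\<^bsub>S\<^esub> Elt w \<one> []"
      using idempotent_mult_word[of w ?q] mult_idempotent[OF one_closed_G, of w ?q]
      by (simp add: act_one word_section_one)
    then have "(\<beta> (Elt w \<one> []) \<otimes>\<^bsub>A\<^esub> \<beta> (Elt ?q \<one> ?q) :: ('x, 'g) isg \<Rightarrow> 'k) =
        \<beta> (Elt (w @ ?q) \<one> (w @ ?q)) \<otimes>\<^bsub>A\<^esub> \<beta> (Elt w \<one> [])"
      by (simp add: basis_elt_mult_basis_elt)
    then have "a \<otimes>\<^bsub>A\<^esub> \<beta> (Elt w \<one> []) \<otimes>\<^bsub>A\<^esub> \<beta> (Elt ?q \<one> ?q) =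
        a \<otimes>\<^bsub>A\<^esub> \<beta> (Elt (w @ ?q) \<one> (w @ ?q)) \<otimes>\<^bsub>A\<^esub> \<beta> (Elt w \<one> [])"
      by (simp add: A.m_assoc)
    also have "\<dots> = (\<lambda>s. 0)"
      by (rule ext) (simp add: r mult_basis_elt)
    finally show ?thesis by blast
  qed
  then show ?thesis by (simp add: mem_singular_ideal)
qed

text \<open>The coefficient \<open>c\<^sub>u\<close> in the expansion \<open>b = \<Sum> u c\<^sub>u\<close> of an element \<open>b\<close> that is supported on
  elements \<open>u g\<close> with \<open>u\<close> a word and \<open>g\<close> in the group; each \<open>c\<^sub>u\<close> lies in the group algebra.\<close>

definition group_part :: "'x list \<Rightarrow> (('x, 'g) isg \<Rightarrow> 'k::field) \<Rightarrow> ('x, 'g) isg \<Rightarrow> 'k" where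
  "group_part u b s =
     (case s of Elt y g z \<Rightarrow> if y = [] \<and> z = [] then b (Elt u g []) else 0 | Zero \<Rightarrow> 0)"

lemma group_part_nonzeroE:
  assumes "group_part u b s \<noteq> 0"
  obtains g where "s = Elt [] g []" "b (Elt u g []) \<noteq> 0"
  using assms by (auto simp: group_part_def split: isg.splits if_splits)

lemma group_part_closed:
  fixes b :: "('x, 'g) isg \<Rightarrow> 'k::field"
  assumes b: "b \<in> carrier A"
  shows "group_part u b \<in> carrier A"
proof -
  let ?f = "\<lambda>s :: ('x, 'g) isg. case s of Elt y g z \<Rightarrow> (Elt [] g [] :: ('x, 'g) isg) | Zero \<Rightarrow> Zero"
  have "{s. group_part u b s \<noteq> 0} \<subseteq> ?f ` {s. b s \<noteq> 0}"
  proof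
    fix s assume "s \<in> {s. group_part u b s \<noteq> 0}"
    then obtain g where "s = Elt [] g []" "b (Elt u g []) \<noteq> 0"
      by (auto elim: group_part_nonzeroE)
    then show "s \<in> ?f ` {s. b s \<noteq> 0}"
      by (intro image_eqI[of _ _ "Elt u g []"]) auto
  qed
  moreover have "{s. group_part u b s \<noteq> 0} \<subseteq> carrier S - {Zero}"
  proof
    fix s assume "s \<in> {s. group_part u b s \<noteq> 0}"
    then obtain g where s: "s = Elt [] g []" "b (Elt u g []) \<noteq> 0"
      by (auto elim: group_part_nonzeroE)
    then have "Elt u g [] \<in> carrier S"
      using b by (auto simp: carrier_contracted_algebra)
    with s show "s \<in> carrier S - {Zero}" by (simp add: mem_carrier_S)
  qed
  ultimately show ?thesis
    using b by (auto simp: carrier_contracted_algebra intro: finite_subset)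
qed

text \<open>If \<open>p p\<^sup>*\<close> annihilates \<open>b\<close>, it annihilates every \<open>c\<^sub>u\<close>: a term \<open>u' k\<close> of \<open>b\<close> contributes
  \<open>u' k(p) k|\<^sub>p p\<^sup>*\<close> to \<open>b p p\<^sup>*\<close>, and since \<open>k(p)\<close> has the length of \<open>p\<close>, the first word of this element
  determines \<open>u'\<close>. The coefficients of \<open>c\<^sub>u p p\<^sup>*\<close> are thus coefficients of \<open>b p p\<^sup>*\<close>.\<close>

lemma group_part_singular:
  fixes b :: "('x, 'g) isg \<Rightarrow> 'k::field"
  assumes b: "b \<in> singular_ideal S Zero"
    and supp: "\<And>s. b s \<noteq> 0 \<Longrightarrow> \<exists>u g. s = Elt u g [] \<and> g \<in> carrier G"
  shows "group_part u b \<in> singular_ideal S Zero"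
proof -
  have bA: "b \<in> carrier A" using b by (simp add: mem_singular_ideal)
  have kill: "group_part u b \<otimes>\<^bsub>A\<^esub> \<beta> (Elt p \<one> p) = (\<lambda>s. 0)"
    if p: "b \<otimes>\<^bsub>A\<^esub> \<beta> (Elt p \<one> p) = (\<lambda>s. 0)" for p
  proof
    fix s
    let ?R = "{r. group_part u b r \<noteq> 0 \<and> r \<otimes>\<^bsub>S\<^esub> Elt p \<one> p = s}"
    have "(\<Sum>r\<in>?R. group_part u b r) = 0"
    proof (cases "?R = {}")
      case False
      then obtain g where g: "b (Elt u g []) \<noteq> 0" "Elt [] g [] \<otimes>\<^bsub>S\<^esub> Elt p \<one> p = s"
        by (auto elim: group_part_nonzeroE)
      have gG: "g \<in> carrier G" using supp[OF g(1)] by auto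
      define y where "y = act g p"
      define h where "h = word_section G act g p"
      have s: "s = Elt y h p"
        using g(2) mult_idempotent[OF gG, of "[]" p] by (simp add: y_def h_def)
      have ly: "length y = length p" using gG by (simp add: y_def length_act)
      \<comment> \<open>The coefficient of \<open>c\<^sub>u p p\<^sup>*\<close> at \<open>s\<close> and that of \<open>b p p\<^sup>*\<close> at \<open>u s\<close> are sums over the same
        group elements.\<close>
      let ?s = "Elt (u @ y) h p"
      let ?R' = "{r. b r \<noteq> 0 \<and> r \<otimes>\<^bsub>S\<^esub> Elt p \<one> p = ?s}"
      have "?R' = (\<lambda>k. Elt u k [] :: ('x, 'g) isg) ` {k. b (Elt u k []) \<noteq> 0 \<and> act k p = y \<and> word_section G act k p = h}"
        (is "_ = _ ` ?K")
      proof (intro equalityI subsetI)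
        fix r assume r: "r \<in> ?R'"
        then obtain u' k where k: "r = Elt u' k []" "k \<in> carrier G" using supp by blast
        then have "length (act k p) = length y" using ly length_act by simp
        then show "r \<in> (\<lambda>k. Elt u k [] :: ('x, 'g) isg) ` ?K"
          using r k mult_idempotent[OF k(2), of u' p] by auto
      next
        fix r assume "r \<in> (\<lambda>k. Elt u k [] :: ('x, 'g) isg) ` ?K"
        then obtain k where k: "r = Elt u k []" "k \<in> ?K" by blast
        then have "k \<in> carrier G" using supp[of "Elt u k []"] by auto
        with k show "r \<in> ?R'" by (simp add: mult_idempotent)
      qed
      moreover have "?R = (\<lambda>k. Elt [] k [] :: ('x, 'g) isg) ` ?K"
      proof (intro equalityI subsetI)
        fix r assume r: "r \<in> ?R"
        then obtain k where k: "r = Elt [] k []" "b (Elt u k []) \<noteq> 0"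
          by (auto elim: group_part_nonzeroE)
        then have "k \<in> carrier G" using supp[of "Elt u k []"] by auto
        with r k s show "r \<in> (\<lambda>k. Elt [] k [] :: ('x, 'g) isg) ` ?K"
          by (simp add: mult_idempotent)
      next
        fix r assume "r \<in> (\<lambda>k. Elt [] k [] :: ('x, 'g) isg) ` ?K"
        then obtain k where k: "r = Elt [] k []" "k \<in> ?K" by blast
        then have "k \<in> carrier G" using supp[of "Elt u k []"] by auto
        with k s show "r \<in> ?R" by (simp add: mult_idempotent group_part_def)
      qed
      moreover have "inj (\<lambda>k. Elt v k [] :: ('x, 'g) isg)" for v
        by (auto simp: inj_on_def)
      ultimately have "(\<Sum>r\<in>?R. group_part u b r) = (\<Sum>r\<in>?R'. b r)"
        by (simp add: sum.reindex[OF inj_on_subset[OF _ subset_UNIV]] group_part_def)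
      also have "\<dots> = (b \<otimes>\<^bsub>A\<^esub> \<beta> (Elt p \<one> p)) ?s"
        by (simp add: mult_basis_elt)
      also have "\<dots> = 0" using p by simp
      finally show ?thesis .
    next
      case True
      show ?thesis unfolding True by simp
    qed
    then show "(group_part u b \<otimes>\<^bsub>A\<^esub> \<beta> (Elt p \<one> p)) s = 0"
      by (simp add: mult_basis_elt)
  qed
  show ?thesis
    using b kill group_part_closed[OF bA] unfolding mem_singular_ideal by blast
qed

text \<open>The expansion \<open>b = \<Sum> u c\<^sub>u\<close> is built up one word at a time, by restricting \<open>b\<close> to the terms
  whose first word lies in a finite set \<open>U\<close>.\<close>

lemma ideal_contains_sum_group_parts:
  fixes b :: "('x, 'g) isg \<Rightarrow> 'k::field"
  assumes J: "ideal J (A :: (('x, 'g) isg \<Rightarrow> 'k) ring)"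
    and b: "b \<in> carrier A"
    and supp: "\<And>s. b s \<noteq> 0 \<Longrightarrow> \<exists>u g. s = Elt u g [] \<and> g \<in> carrier G"
    and parts: "\<And>u. group_part u b \<in> J"
  shows "b \<in> J"
proof -
  interpret ideal J "A :: (('x, 'g) isg \<Rightarrow> 'k) ring" by (rule J)
  let ?r = "\<lambda>U s. case s of Elt u g z \<Rightarrow> if u \<in> U then b s else 0 | Zero \<Rightarrow> 0"
  have restricted: "?r U \<in> J" if "finite U" for U
    using that
  proof induction
    case empty
    have "?r {} = \<zero>\<^bsub>A\<^esub>"
      by (auto simp: contracted_algebra_def split: isg.splits)
    then show ?case using zero_closed by simp
  next
    case (insert u U)
    have eval: "(\<beta> (Elt u \<one> []) \<otimes>\<^bsub>A\<^esub> group_part u b) s =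
        (case s of Elt v g z \<Rightarrow> if v = u then b s else 0 | Zero \<Rightarrow> 0)" for s
    proof -
      have "{r. group_part u b r \<noteq> 0 \<and> Elt u \<one> [] \<otimes>\<^bsub>S\<^esub> r = s} =
          (case s of Elt v g z \<Rightarrow> if v = u \<and> z = [] \<and> b s \<noteq> 0 then {Elt [] g []} else {}
           | Zero \<Rightarrow> {})" (is "?L = ?R")
      proof (intro equalityI subsetI)
        fix r assume r: "r \<in> ?L"
        then obtain k where k: "r = Elt [] k []" "b (Elt u k []) \<noteq> 0"
          by (auto elim: group_part_nonzeroE)
        then have "k \<in> carrier G" using supp[of "Elt u k []"] by auto
        with r k show "r \<in> ?R" by (auto simp: word_mult_group_elt)
      next
        fix r assume "r \<in> ?R"
        then obtain k where k: "s = Elt u k []" "r = Elt [] k []" "b (Elt u k []) \<noteq> 0"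
          by (auto split: isg.splits if_splits)
        then have "k \<in> carrier G" using supp[of "Elt u k []"] by auto
        with k show "r \<in> ?L" by (simp add: word_mult_group_elt group_part_def)
      qed
      moreover have "z = []" if "b (Elt v g z) \<noteq> 0" for v g z
        using supp[OF that] by auto
      ultimately show ?thesis
        by (auto simp: basis_elt_mult group_part_def split: isg.splits)
    qed
    have "?r (insert u U) = \<beta> (Elt u \<one> []) \<otimes>\<^bsub>A\<^esub> group_part u b \<oplus>\<^bsub>A\<^esub> ?r U"
    proof
      fix s
      have add: "(f \<oplus>\<^bsub>A\<^esub> f') s = f s + f' s" for f f' :: "('x, 'g) isg \<Rightarrow> 'k"
        by (simp add: contracted_algebra_def)
      show "?r (insert u U) s = (\<beta> (Elt u \<one> []) \<otimes>\<^bsub>A\<^esub> group_part u b \<oplus>\<^bsub>A\<^esub> ?r U) s"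
        unfolding add eval using insert.hyps by (auto split: isg.splits)
    qed
    moreover have "\<beta> (Elt u \<one> []) \<in> carrier (A :: (('x, 'g) isg \<Rightarrow> 'k) ring)"
      by (intro basis_elt_closed Elt_closed one_closed_G)
    ultimately show ?case
      using insert.IH parts[of u]
      by (simp add: I_l_closed additive_subgroup.a_closed[OF is_additive_subgroup])
  qed
  define U where "U = (\<lambda>s. case s of Elt u g z \<Rightarrow> u | Zero \<Rightarrow> []) ` {s. b s \<noteq> 0}"
  have "finite U" using b by (simp add: U_def carrier_contracted_algebra)
  have "?r U = b"
  proof
    fix s show "?r U s = b s"
    proof (cases "b s = 0")
      case False
      then obtain u g where "s = Elt u g []" using supp by blast
      with False show ?thesis by (force simp: U_def)
    qed (auto split: isg.splits)
  qed
  with restricted[OF \<open>finite U\<close>] show ?thesis by simp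
qed


section \<open>Multiplication by long words\<close>

text \<open>As \<open>w\<close> is at least as long as \<open>v\<close>, the product \<open>v\<^sup>* w\<close> is \<open>0\<close> or the word that remains of \<open>w\<close>
  after \<open>v\<close>, over which \<open>g\<close> then moves.\<close>

lemma mult_long_word:
  assumes "g \<in> carrier G" "length v \<le> length w" "Elt u g v \<otimes>\<^bsub>S\<^esub> Elt w \<one> [] \<noteq> Zero"
  shows "\<exists>u'. Elt u g v \<otimes>\<^bsub>S\<^esub> Elt w \<one> [] = Elt u' (word_section G act g (drop (length v) w)) []"
proof -
  interpret group G by (rule group_G)
  have "prefix v w"
    using assms by (auto simp: mult_S prefix_def split: if_splits)
  with assms(1) show ?thesis by (simp add: mult_S word_section_closed Let_def)
qed

text \<open>The support of \<open>a\<close> is finite, so one length \<open>n\<close> serves all terms \<open>u g v\<^sup>*\<close>: it exceeds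
  the length of \<open>v\<close> by so much that the section of \<open>g\<close> at the remaining word lies in \<open>N\<close>.\<close>

lemma support_mult_long_word:
  fixes a :: "('x, 'g) isg \<Rightarrow> 'k::field"
  assumes N: "contracting_set G act N" and a: "a \<in> carrier A"
  obtains n where "\<And>w s. length w = n \<Longrightarrow> (a \<otimes>\<^bsub>A\<^esub> \<beta> (Elt w \<one> [])) s \<noteq> 0 \<Longrightarrow>
    \<exists>u g. s = Elt u g [] \<and> g \<in> N"
proof -
  define long where "long s n \<longleftrightarrow>
    (\<forall>u g v. s = Elt u g v \<longrightarrow>
       length v \<le> n \<and> (\<forall>w. length v + length w = n \<longrightarrow> word_section G act g w \<in> N))"
    for s :: "('x, 'g) isg" and n
  have "eventually (long s) sequentially" if "a s \<noteq> 0" for s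
  proof -
    have "s \<in> carrier S" "s \<noteq> Zero" using a that by (auto simp: carrier_contracted_algebra)
    then obtain u g v where s: "s = Elt u g v" "g \<in> carrier G" by (auto simp: mem_carrier_S)
    obtain m where "\<And>w. length w \<ge> m \<Longrightarrow> word_section G act g w \<in> N"
      using contracting_set_eventually[OF N s(2)] by blast
    then have "long s n" if "n \<ge> length v + m" for n
      using that s by (auto simp: long_def)
    then show ?thesis by (auto simp: eventually_sequentially)
  qed
  moreover have "finite {s. a s \<noteq> 0}" using a by (simp add: carrier_contracted_algebra)
  ultimately have "eventually (\<lambda>n. \<forall>s\<in>{s. a s \<noteq> 0}. long s n) sequentially"
    by (intro eventually_ball_finite) auto
  then obtain n where n: "\<And>s. a s \<noteq> 0 \<Longrightarrow> long s n"
    by (auto simp: eventually_sequentially)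
  have "\<exists>u g. s = Elt u g [] \<and> g \<in> N"
    if w: "length w = n" and s: "(a \<otimes>\<^bsub>A\<^esub> \<beta> (Elt w \<one> [])) s \<noteq> 0" for w s
  proof -
    have "s \<noteq> Zero" "(\<Sum>r | a r \<noteq> 0 \<and> r \<otimes>\<^bsub>S\<^esub> Elt w \<one> [] = s. a r) \<noteq> 0"
      using s by (auto simp: mult_basis_elt split: if_splits)
    then obtain r where r: "a r \<noteq> 0" "r \<otimes>\<^bsub>S\<^esub> Elt w \<one> [] = s"
      by (auto elim: sum.not_neutral_contains_not_neutral)
    then have "r \<in> carrier S" "r \<noteq> Zero" using a by (auto simp: carrier_contracted_algebra)
    then obtain u g v where rE: "r = Elt u g v" "g \<in> carrier G" by (auto simp: mem_carrier_S)
    have "length v \<le> n" "word_section G act g (drop (length v) w) \<in> N"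
      using n[OF r(1)] rE w by (auto simp: long_def)
    with mult_long_word[OF rE(2), of v w u] rE r w \<open>s \<noteq> Zero\<close> show ?thesis by auto
  qed
  then show ?thesis using that by blast
qed

text \<open>The words of length \<open>n\<close> cover the identity, so some \<open>a w w\<^sup>*\<close> is outside \<open>J\<close>; and \<open>a w w\<^sup>*\<close> is
  a multiple of \<open>a w\<close>.\<close>

lemma nonmember_times_long_word:
  fixes a :: "('x, 'g) isg \<Rightarrow> 'k::field"
  assumes J: "ideal J (A :: (('x, 'g) isg \<Rightarrow> 'k) ring)"
    and tight: "{diff_prod S Zero e fs | e fs.
                   e \<in> idempotents S \<and> distinct fs \<and> covers S Zero (set fs) e} \<subseteq> J"
    and a: "a \<in> carrier A" "a \<notin> J"
  obtains w where "length w = n" "a \<otimes>\<^bsub>A\<^esub> \<beta> (Elt w \<one> []) \<notin> J"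
proof -
  interpret ideal J "A :: (('x, 'g) isg \<Rightarrow> 'k) ring" by (rule J)
  have one: "\<beta> \<one>\<^bsub>S\<^esub> = (\<one>\<^bsub>A\<^esub> :: ('x, 'g) isg \<Rightarrow> 'k)"
    by (auto simp: basis_elt_def contracted_algebra_def)
  have "\<one>\<^bsub>S\<^esub> \<in> idempotents S"
    using nonzero_idempotents one_S by metis
  moreover have "finite ((\<lambda>w :: 'x list. Elt w \<one> w) ` {w. length w = n})"
    using finite_lists_length_eq[of "UNIV :: 'x set" n] by simp
  moreover have "a \<otimes>\<^bsub>A\<^esub> \<beta> \<one>\<^bsub>S\<^esub> = a"
    unfolding one using a(1) by simp
  ultimately obtain w where w: "length w = n" "a \<otimes>\<^bsub>A\<^esub> \<beta> (Elt w \<one> w) \<notin> J"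
    using nonmember_times_cover[OF J tight _ _ words_cover_one a] by blast
  have cl: "\<beta> (Elt u \<one> v) \<in> carrier (A :: (('x, 'g) isg \<Rightarrow> 'k) ring)" for u v
    by (intro basis_elt_closed Elt_closed one_closed_G)
  have "\<beta> (Elt w \<one> w) = (\<beta> (Elt w \<one> []) \<otimes>\<^bsub>A\<^esub> \<beta> (Elt [] \<one> w) :: ('x, 'g) isg \<Rightarrow> 'k)"
    by (simp add: basis_elt_mult_basis_elt word_mult_star)
  then have "a \<otimes>\<^bsub>A\<^esub> \<beta> (Elt w \<one> w) = a \<otimes>\<^bsub>A\<^esub> \<beta> (Elt w \<one> []) \<otimes>\<^bsub>A\<^esub> \<beta> (Elt [] \<one> w)"
    using a(1) cl by (simp add: m_assoc)
  with w(2) have "a \<otimes>\<^bsub>A\<^esub> \<beta> (Elt w \<one> []) \<notin> J"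
    using I_r_closed cl by metis
  with w(1) show ?thesis by (rule that)
qed

end


theorem proposition5p7:
  fixes G :: "('g, 'm) monoid_scheme"
    and act :: "'g \<Rightarrow> 'x::finite list \<Rightarrow> 'x list"
    and N :: "'g set"
  assumes "self_similar_group G act"
    and "contracting G act"
    and "is_nucleus G act N"
    and "(singular_ideal (isg_monoid G act) Zero :: (('x, 'g) isg \<Rightarrow> 'k::field) set)
           - tight_ideal (isg_monoid G act) Zero \<noteq> {}"
  shows "((singular_ideal (isg_monoid G act) Zero :: (('x, 'g) isg \<Rightarrow> 'k) set)
           - tight_ideal (isg_monoid G act) Zero)
         \<inter> lin_span ((\<lambda>g. basis_elt Zero (Elt [] g [])) ` N) \<noteq> {}"
proof -
  interpret self_similar_group G act by fact
  have N: "contracting_set G act N"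
    using \<open>is_nucleus G act N\<close> by (simp add: is_nucleus_def)
  then have NG: "N \<subseteq> carrier G" "finite N" by (auto simp: contracting_set_def)
  obtain a :: "('x, 'g) isg \<Rightarrow> 'k"
    where a: "a \<in> singular_ideal S Zero" "a \<notin> tight_ideal S Zero"
    using assms(4) by blast
  obtain J where J: "ideal J (A :: (('x, 'g) isg \<Rightarrow> 'k) ring)" and aJ: "a \<notin> J"
    and tight: "{diff_prod S Zero e fs | e fs.
                   e \<in> idempotents S \<and> distinct fs \<and> covers S Zero (set fs) e} \<subseteq> J"
    using not_in_tight_idealD[OF a(2)] by blast
  have aA: "a \<in> carrier A" using a by (simp add: mem_singular_ideal)
  obtain n where n: "\<And>w s. length w = n \<Longrightarrow> (a \<otimes>\<^bsub>A\<^esub> \<beta> (Elt w \<one>\<^bsub>G\<^esub> [])) s \<noteq> 0 \<Longrightarrow>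
      \<exists>u g. s = Elt u g [] \<and> g \<in> N"
    using support_mult_long_word[OF N aA] by blast
  obtain w where w: "length w = n" "a \<otimes>\<^bsub>A\<^esub> \<beta> (Elt w \<one>\<^bsub>G\<^esub> []) \<notin> J"
    using nonmember_times_long_word[OF J tight aA aJ] by blast
  define b where "b = a \<otimes>\<^bsub>A\<^esub> \<beta> (Elt w \<one>\<^bsub>G\<^esub> [])"
  have bN: "\<And>s. b s \<noteq> 0 \<Longrightarrow> \<exists>u g. s = Elt u g [] \<and> g \<in> N"
    using n[OF w(1)] by (simp add: b_def)
  then have bG: "\<And>s. b s \<noteq> 0 \<Longrightarrow> \<exists>u g. s = Elt u g [] \<and> g \<in> carrier G"
    using NG by blast
  have b: "b \<in> singular_ideal S Zero" "b \<notin> J"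
    using singular_ideal_mult_word[OF ideal.axioms(2)[OF J] a(1)] w(2) by (auto simp: b_def)
  then have "b \<in> carrier A" by (simp add: mem_singular_ideal)
  then obtain u where u: "group_part u b \<notin> J"
    using ideal_contains_sum_group_parts[OF J _ bG] b(2) by blast
  have "group_part u b \<notin> tight_ideal S Zero"
    using u J tight unfolding tight_ideal_def genideal_def by blast
  moreover have "group_part u b \<in> singular_ideal S Zero"
    by (rule group_part_singular[OF b(1) bG])
  moreover have "group_part u b \<in> lin_span (basis_elt Zero ` (\<lambda>g. Elt [] g []) ` N)"
  proof (rule supported_in_lin_span)
    fix s assume "group_part u b s \<noteq> 0"
    then obtain g where "s = Elt [] g []" "b (Elt u g []) \<noteq> 0" by (rule group_part_nonzeroE)
    with bN[of "Elt u g []"] show "s \<in> (\<lambda>g. Elt [] g []) ` N" by auto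
  qed (use NG in auto)
  ultimately show ?thesis
    unfolding image_image by blast
qed

end
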